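(* Let $m,n,k$ be even integers with $0\le k\le\min(m,n)$, let $m'=m+n-2k$, and suppose $m\ge2$ and $m'\ge 2$. Let $$X=c_{m,n,k}\left(\tfrac m2,\tfrac n2\right)=(-1)^{k/2}\,\frac{\left(\frac{m+n-k}{2}\right)!}{\left(\frac{m-k}{2}\right)!\left(\frac{n-k}{2}\right)!\left(\frac k2\right)!}$$ be the central value of $M(m,n,k)$. For $1\le s\le m/2$, let $A_sX$ be the entry of $M(m,n,k)$ lying $s$ rows below the central entry in the same column (that is, $c_{m,n,k}(\frac m2+s,\frac n2-s)$), and let $B_sX$ be the entry immediately to the right of it (that is, $c_{m,n,k}(\frac m2+s,\frac n2-s+1)$). Then, with $\lambda_s=s(s+2)$, $$A_1=\frac{\lambda_{m'}-\lambda_m-\lambda_n}{2\lambda_m},\qquad B_1=\frac{\lambda_{m'}+\lambda_m-\lambda_n}{2\lambda_m},$$ and, for $1\le s<m/2$, $$A_{s+1}=\frac{(\lambda_{m'}-\lambda_m+\lambda_{2s})A_s+(\lambda_{2s-2}-\lambda_n)B_s}{\lambda_m-\lambda_{2s}},\qquad B_{s+1}=\frac{\lambda_{m'}A_s+(\lambda_{2s-2}-\lambda_n)B_s}{\lambda_m-\lambda_{2s}}.$$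
   Context: For integers $m,n,k,i,j$ with $0\le k\le\min(m,n)$, $0\le i\le m$, $0\le j\le n$, $0\le i+j-k\le m+n-2k$, define $$c_{m,n,k}(i,j)=\sum_{l=0}^{k}(-1)^l\binom{i+j-k}{i-l}\binom{m-l}{k-l}\binom{n-k+l}{l},$$ where $\binom{a}{b}=0$ if $b<0$ or $b>a$. The matrix $M(m,n,k)$ has $m+1$ rows and $m+n-2k+1$ columns; its entry in row $i+1$ and column $i+j-k+1$ is $c_{m,n,k}(i,j)$ when $0\le j\le n$, and $0$ when $j<0$ or $j>n$ (so $c_{m,n,k}(i,j)$ is extended by zero to all entries of $M(m,n,k)$). *)

theory Defs
  imports Complex_Main "Jordan_Normal_Form.Matrix"
begin

text \<open>Binomial coefficient vanishing for a negative lower argument or a lower argument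
  exceeding the upper one. Truncated subtraction on \<^typ>\<open>nat\<close> would give wrong values here.\<close>

definition zbinom :: "int \<Rightarrow> int \<Rightarrow> int" where
  "zbinom a b = (if 0 \<le> b \<and> b \<le> a then int (nat a choose nat b) else 0)"

definition ccoef :: "nat \<Rightarrow> nat \<Rightarrow> nat \<Rightarrow> int \<Rightarrow> int \<Rightarrow> int" where
  "ccoef m n k i j =
     (\<Sum>l=0..k. (-1) ^ l * zbinom (i + j - int k) (i - int l)
                 * zbinom (int m - int l) (int k - int l)
                 * zbinom (int n - int k + int l) (int l))"

definition ccoef_ext :: "nat \<Rightarrow> nat \<Rightarrow> nat \<Rightarrow> int \<Rightarrow> int \<Rightarrow> int" where
  "ccoef_ext m n k i j = (if 0 \<le> j \<and> j \<le> int n then ccoef m n k i j else 0)"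

text \<open>Rows and columns are indexed from 0, so \<open>c(i, j)\<close> is placed in row \<open>i\<close> and
  column \<open>q = i + j - k\<close>, that is \<open>j = q + k - i\<close>. The number of columns is the intended one
  for \<open>k \<le> min m n\<close>.\<close>

definition Mmat :: "nat \<Rightarrow> nat \<Rightarrow> nat \<Rightarrow> int mat" where
  "Mmat m n k = mat (m + 1) (m + n - 2 * k + 1)
     (\<lambda>(i, q). ccoef_ext m n k (int i) (int q + int k - int i))"

definition lam :: "nat \<Rightarrow> rat" where
  "lam s = of_nat s * (of_nat s + 2)"

end

theory Submission
  imports Defs
begin

text \<open>Up to the factor \<open>(-1)^k q! (m-i)! (n-j)!\<close> with \<open>q = i + j - k\<close>, the number \<open>c(i, j)\<close> is the
  coefficient of a monomial in the invariant
  \<open>(x\<^sub>1 y\<^sub>2 - x\<^sub>2 y\<^sub>1)^k (x\<^sub>1 z\<^sub>2 + x\<^sub>2 z\<^sub>1)^(m-k) (y\<^sub>1 z\<^sub>2 + y\<^sub>2 z\<^sub>1)^(n-k)\<close>, divided by \<open>k! (m-k)! (n-k)!\<close>;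
  this quotient is \<open>wsum\<close> below. In that form the symmetry \<open>(i, j) \<mapsto> (m - i, n - j)\<close> is visible; it
  turns the Pascal rule \<open>c(i, j) = c(i-1, j) + c(i, j-1)\<close> into a second
  three-term relation (the two relations express equivariance under \<open>sl\<^sub>2\<close>), and together they give
  the recurrences. The central value is Dixon's sum, evaluated by telescoping.\<close>

section \<open>Reciprocal factorials and Pascal's rule\<close>

text \<open>The entire function 1/Gamma(z+1) at the integers: the poles of the factorial become
  zeros, so summation bounds and vanishing binomials need no case distinctions.\<close>

definition rfact :: "int \<Rightarrow> rat" where
  "rfact z = (if z < 0 then 0 else 1 / fact (nat z))"

lemma rfact_neg [simp]: "z < 0 \<Longrightarrow> rfact z = 0"
  by (simp add: rfact_def)

lemma rfact_of_nat [simp]: "rfact (int n) = 1 / fact n"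
  by (simp add: rfact_def)

lemma rfact_0 [simp]: "rfact 0 = 1"
  by (simp add: rfact_def)

text \<open>At \<open>z = 0\<close> both sides vanish, so the rule holds for every integer; it
  reduces relations between shifted summands to polynomial identities.\<close>

lemma rfact_pred: "rfact (z - 1) = of_int z * rfact z"
proof (cases "z \<le> 0")
  case True
  then show ?thesis by (cases "z = 0") auto
next
  case False
  then obtain n where "z = int (Suc n)"
    by (metis not_le pos_int_cases Suc_pred)
  then have z: "z = int (Suc n)" "z - 1 = int n" by auto
  show ?thesis unfolding z(2) unfolding z(1) rfact_of_nat
    by (simp add: divide_simps)
qed

lemma fact_nat_rec: "0 \<le> z \<Longrightarrow> (fact (nat (z + 1)) :: rat) = of_int (z + 1) * fact (nat z)"
  by (simp add: nat_add_distrib)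

lemma zbinom_rfact: "0 \<le> a \<Longrightarrow> of_int (zbinom a b) = fact (nat a) * rfact b * rfact (a - b)"
  by (auto simp: zbinom_def rfact_def binomial_fact nat_diff_distrib nat_le_eq_zle)

text \<open>The bound excludes \<open>a = b = 0\<close>, where the left side is 1 and the right side
  0.\<close>

lemma zbinom_pascal:
  assumes "1 \<le> a"
  shows "zbinom a b = zbinom (a - 1) (b - 1) + zbinom (a - 1) b"
proof -
  define R where "R = rfact b * rfact (a - b)"
  have f: "(fact (nat a) :: rat) = of_int a * fact (nat (a - 1))"
    using fact_nat_rec[of "a - 1"] assms by simp
  have e: "a - 1 - b = a - b - 1" "a - 1 - (b - 1) = a - b" by auto
  have "(of_int (zbinom a b) :: rat) = of_int (zbinom (a - 1) (b - 1) + zbinom (a - 1) b)"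
    unfolding of_int_add using assms
    by (simp add: zbinom_rfact f e rfact_pred[of b] rfact_pred[of "a - b"]) (simp add: algebra_simps)
  then show ?thesis by (simp only: of_int_eq_iff)
qed

text \<open>Only the first binomial of each summand depends on \<open>i\<close> and
  \<open>j\<close>, and it obeys Pascal's rule.\<close>

lemma ccoef_pascal:
  assumes "1 \<le> i + j - int k"
  shows "ccoef m n k i j = ccoef m n k (i - 1) j + ccoef m n k i (j - 1)"
proof -
  have "zbinom (i + j - int k) (i - int l)
      = zbinom (i - 1 + j - int k) (i - 1 - int l) + zbinom (i + (j - 1) - int k) (i - int l)" for l
    using zbinom_pascal[OF assms, of "i - int l"] by (simp add: algebra_simps)
  then show ?thesis
    unfolding ccoef_def sum.distrib[symmetric] by (simp add: algebra_simps)
qed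

section \<open>The symmetric sum and its two three-term relations\<close>

text \<open>Here \<open>t\<close> counts the brackets that contribute
  \<open>- x\<^sub>2 y\<^sub>1\<close>; the exponents of \<open>x\<^sub>1\<close>,
  \<open>y\<^sub>1\<close>, \<open>z\<^sub>2\<close> in the monomial are \<open>i\<close>,
  \<open>j\<close>, \<open>i + j - k\<close>.\<close>

definition wterm :: "nat \<Rightarrow> nat \<Rightarrow> nat \<Rightarrow> int \<Rightarrow> int \<Rightarrow> nat \<Rightarrow> rat" where
  "wterm m n k i j t = (-1) ^ t * rfact (int t) * rfact (int k - int t)
     * rfact (i - int k + int t) * rfact (int m - i - int t)
     * rfact (j - int t) * rfact (int n - int k - j + int t)"

definition wsum :: "nat \<Rightarrow> nat \<Rightarrow> nat \<Rightarrow> int \<Rightarrow> int \<Rightarrow> rat" where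
  "wsum m n k i j = (\<Sum>t\<le>k. wterm m n k i j t)"

text \<open>Reversing the sum swaps the six factors in pairs. This is the exchange of the subscripts
  1 and 2, which negates the bracket
  \<open>x\<^sub>1 y\<^sub>2 - x\<^sub>2 y\<^sub>1\<close>.\<close>

lemma wsum_reflect: "wsum m n k (int m - i) (int n - j) = (-1) ^ k * wsum m n k i j"
proof -
  have "wsum m n k (int m - i) (int n - j)
      = (\<Sum>t\<le>k. wterm m n k (int m - i) (int n - j) (k - t))"
    unfolding wsum_def by (rule sum.nat_diff_reindex[symmetric, of _ "Suc k", unfolded lessThan_Suc_atMost diff_Suc_Suc])
  also have "\<dots> = (\<Sum>t\<le>k. (-1) ^ k * wterm m n k i j t)"
  proof (rule sum.cong[OF refl])
    fix t assume "t \<in> {..k}"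
    then obtain d where k: "k = t + d" by (auto dest: le_Suc_ex)
    have "(-1) ^ d = (-1) ^ (t + d) * (-1 :: rat) ^ t"
      by (simp add: power_add algebra_simps flip: power_mult_distrib)
    then show "wterm m n k (int m - i) (int n - j) (k - t) = (-1) ^ k * wterm m n k i j t"
      unfolding wterm_def k by (simp add: algebra_simps)
  qed
  finally show ?thesis by (simp add: wsum_def sum_distrib_left)
qed

text \<open>Creative telescoping: the same combination of summands is a difference of consecutive
  values of a certificate \<open>g\<close>.\<close>

lemma wsum_pascal:
  "of_int (i + j - int k) * wsum m n k i j
    = of_int (int m - i + 1) * wsum m n k (i - 1) j + of_int (int n - j + 1) * wsum m n k i (j - 1)"
proof -
  define g where "g t = (-1) ^ t * rfact (int t - 1) * rfact (int k - int t)
     * rfact (i - 1 - int k + int t) * rfact (int m - i + 1 - int t)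
     * rfact (j - int t) * rfact (int n - int k - j + int t)" for t
  have eq: "of_int (int m - i + 1) * wterm m n k (i - 1) j t
      + of_int (int n - j + 1) * wterm m n k i (j - 1) t
      - of_int (i + j - int k) * wterm m n k i j t = g t - g (Suc t)" for t
  proof -
    \<comment> \<open>Each name is the largest argument of its factorial, so every term is a
      polynomial multiple of one product. What remains is
      \<open>(x+u)*p*y + (y+v)*x*r - (p+r)*x*y = u*p*y + v*x*r\<close>.\<close>
    define u v p x r y :: int where "u = int t" and "v = int k - int t"
      and "p = i - int k + int t" and "x = int m - i + 1 - int t"
      and "r = j - int t" and "y = int n - int k - j + int t + 1"
    have w1: "wterm m n k (i - 1) j t
        = (-1) ^ t * rfact u * rfact v * rfact (p - 1) * rfact x * rfact r * rfact (y - 1)"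
      unfolding wterm_def u_def v_def p_def x_def r_def y_def by (simp add: algebra_simps)
    have w2: "wterm m n k i (j - 1) t
        = (-1) ^ t * rfact u * rfact v * rfact p * rfact (x - 1) * rfact (r - 1) * rfact y"
      unfolding wterm_def u_def v_def p_def x_def r_def y_def by (simp add: algebra_simps)
    have w3: "wterm m n k i j t
        = (-1) ^ t * rfact u * rfact v * rfact p * rfact (x - 1) * rfact r * rfact (y - 1)"
      unfolding wterm_def u_def v_def p_def x_def r_def y_def by (simp add: algebra_simps)
    have g1: "g t = (-1) ^ t * rfact (u - 1) * rfact v * rfact (p - 1) * rfact x * rfact r * rfact (y - 1)"
      unfolding g_def u_def v_def p_def x_def r_def y_def by (simp add: algebra_simps)
    have g2: "g (Suc t)
        = - ((-1) ^ t * rfact u * rfact (v - 1) * rfact p * rfact (x - 1) * rfact (r - 1) * rfact y)"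
      unfolding g_def u_def v_def p_def x_def r_def y_def by (simp add: algebra_simps)
    have c: "int m - i + 1 = x + u" "int n - j + 1 = y + v" "i + j - int k = p + r"
      by (simp_all add: u_def v_def p_def x_def r_def y_def)
    show ?thesis
      unfolding w1 w2 w3 g1 g2 c rfact_pred[of u] rfact_pred[of v] rfact_pred[of p]
        rfact_pred[of x] rfact_pred[of r] rfact_pred[of y] of_int_add
      by (simp add: algebra_simps)
  qed
  \<comment> \<open>Both boundary values, \<open>g 0\<close> and \<open>g (Suc k)\<close>, contain
    the factor \<open>rfact (-1) = 0\<close>.\<close>
  have "(\<Sum>t\<le>k. g t - g (Suc t)) = 0"
    unfolding sum_telescope by (simp add: g_def)
  then show ?thesis
    unfolding eq[symmetric] sum.distrib sum_subtractf wsum_def sum_distrib_left by simp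
qed

text \<open>This is \<open>wsum_pascal\<close> at the reflected point, with the common sign
  \<open>(-1) ^ k\<close> cancelled.\<close>

lemma wsum_pascal_reflected:
  "of_int (int m + int n - int k - i - j) * wsum m n k i j
    = of_int (i + 1) * wsum m n k (i + 1) j + of_int (j + 1) * wsum m n k i (j + 1)"
proof -
  have e: "int m - i - 1 = int m - (i + 1)" "int n - j - 1 = int n - (j + 1)"
    "int m - i + (int n - j) - int k = int m + int n - int k - i - j"
    "int m - (int m - i) + 1 = i + 1" "int n - (int n - j) + 1 = j + 1"
    by auto
  have "(-1) ^ k * (of_int (int m + int n - int k - i - j) * wsum m n k i j)
    = (-1) ^ k * (of_int (i + 1) * wsum m n k (i + 1) j + of_int (j + 1) * wsum m n k i (j + 1))"
    using wsum_pascal[of "int m - i" "int n - j" k m n]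
    unfolding e wsum_reflect by (simp add: algebra_simps)
  then show ?thesis by simp
qed

section \<open>From the matrix entries to the symmetric sum\<close>

text \<open>In the first column each sum has at most one nonzero term, \<open>l = i\<close> in
  \<open>ccoef\<close> and \<open>t = j\<close> in \<open>wsum\<close>, and none when
  \<open>i\<close> lies outside \<open>0..k\<close>.\<close>

lemma ccoef_eq_wsum_base:
  assumes "k \<le> min m n" and ij: "i + j = int k"
  shows "of_int (ccoef m n k i j)
    = (-1) ^ k * fact (nat (int m - i)) * fact (nat (int n - j)) * wsum m n k i j"
proof (cases "0 \<le> i \<and> i \<le> int k")
  case True
  then obtain a b where ab: "i = int a" "j = int b" "k = a + b"
    using ij by (metis zero_le_imp_eq_int add_diff_cancel_left' diff_ge_0_iff_ge of_nat_add of_nat_eq_iff)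
  have "ccoef m n k i j = (\<Sum>l=0..k. if l = a then
      (-1) ^ a * zbinom (int m - int a) (int b) * zbinom (int n - int k + int a) (int a) else 0)"
    unfolding ccoef_def by (rule sum.cong) (auto simp: ab zbinom_def)
  also have "\<dots> = (-1) ^ a * zbinom (int m - int a) (int b) * zbinom (int n - int b) (int a)"
    by (simp add: ab)
  finally have c: "ccoef m n k i j = \<dots>" .
  have "wsum m n k i j = (\<Sum>t\<le>k. if t = b then (-1) ^ b * rfact (int b) * rfact (int a)
      * rfact (int m - int k) * rfact (int n - int k) else 0)"
    unfolding wsum_def by (rule sum.cong) (auto simp: ab wterm_def rfact_def diff_diff_eq)
  also have "\<dots> = (-1) ^ b * rfact (int b) * rfact (int a) * rfact (int m - int k) * rfact (int n - int k)"
    by (simp add: ab)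
  finally have w: "wsum m n k i j = \<dots>" .
  have s: "(-1 :: rat) ^ k * (-1) ^ b = (-1) ^ a"
    by (simp add: ab power_add flip: power_mult_distrib)
  have d: "int m - int a - int b = int m - int k" "int n - int b - int a = int n - int k"
    by (simp_all add: ab)
  have le: "0 \<le> int m - int a" "0 \<le> int n - int b" using assms ab by auto
  show ?thesis unfolding c w of_int_mult zbinom_rfact[OF le(1)] zbinom_rfact[OF le(2)] d
    unfolding ab(1,2) by (simp add: s)
next
  case False
  have "ccoef m n k i j = 0"
    unfolding ccoef_def by (rule sum.neutral) (use False ij in \<open>auto simp: zbinom_def\<close>)
  moreover have "wsum m n k i j = 0"
    unfolding wsum_def by (rule sum.neutral) (use False ij in \<open>auto simp: wterm_def rfact_def\<close>)
  ultimately show ?thesis by simp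
qed

lemma ccoef_eq_wsum:
  assumes "k \<le> min m n"
  shows "i + j = int k + int q \<Longrightarrow> i \<le> int m \<Longrightarrow> j \<le> int n \<Longrightarrow>
    of_int (ccoef m n k i j)
      = (-1) ^ k * fact q * fact (nat (int m - i)) * fact (nat (int n - j)) * wsum m n k i j"
proof (induction q arbitrary: i j)
  case 0
  then show ?case using ccoef_eq_wsum_base[OF assms, of i j] by simp
next
  case (Suc q)
  have fm: "(fact (nat (int m - (i - 1))) :: rat) = of_int (int m - i + 1) * fact (nat (int m - i))"
    using fact_nat_rec[of "int m - i"] Suc.prems by (simp add: algebra_simps)
  have fn: "(fact (nat (int n - (j - 1))) :: rat) = of_int (int n - j + 1) * fact (nat (int n - j))"
    using fact_nat_rec[of "int n - j"] Suc.prems by (simp add: algebra_simps)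
  have q: "i + j - int k = int (Suc q)" using Suc.prems by simp
  have "(of_int (ccoef m n k i j) :: rat)
      = of_int (ccoef m n k (i - 1) j) + of_int (ccoef m n k i (j - 1))"
    using ccoef_pascal[of i j k m n] q by simp
  also have "\<dots> = (-1) ^ k * fact q * fact (nat (int m - i)) * fact (nat (int n - j))
      * (of_int (int m - i + 1) * wsum m n k (i - 1) j + of_int (int n - j + 1) * wsum m n k i (j - 1))"
    using Suc.prems by (subst (1 2) Suc.IH) (simp_all only: fm fn, simp_all add: algebra_simps)
  also have "\<dots> = (-1) ^ k * fact (Suc q) * fact (nat (int m - i)) * fact (nat (int n - j)) * wsum m n k i j"
    unfolding wsum_pascal[symmetric] q by (simp add: algebra_simps)
  finally show ?case .
qed

text \<open>This is \<open>wsum_pascal_reflected\<close> with the weights restored; the strict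
  bounds keep both successors within the range of \<open>ccoef_eq_wsum\<close>.\<close>

lemma ccoef_reflected_pascal:
  assumes "k \<le> min m n" "0 \<le> i + j - int k" "i < int m" "j < int n"
  shows "(i + j - int k + 1) * (int m + int n - int k - i - j) * ccoef m n k i j
    = (i + 1) * (int m - i) * ccoef m n k (i + 1) j + (j + 1) * (int n - j) * ccoef m n k i (j + 1)"
proof -
  define q where "q = nat (i + j - int k)"
  have q: "i + j = int k + int q" using assms by (simp add: q_def)
  have fm: "(fact (nat (int m - i)) :: rat) = of_int (int m - i) * fact (nat (int m - (i + 1)))"
    using fact_nat_rec[of "int m - (i + 1)"] assms by simp
  have fn: "(fact (nat (int n - j)) :: rat) = of_int (int n - j) * fact (nat (int n - (j + 1)))"
    using fact_nat_rec[of "int n - (j + 1)"] assms by simp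
  \<comment> \<open>The common part of the three weights; each weight is \<open>Z\<close> times two
    linear factors.\<close>
  define Z where "Z = (-1) ^ k * fact q * fact (nat (int m - (i + 1))) * (fact (nat (int n - (j + 1))) :: rat)"
  have c0: "of_int (ccoef m n k i j) = of_int (int m - i) * of_int (int n - j) * Z * wsum m n k i j"
    using ccoef_eq_wsum[OF assms(1) q] assms by (simp only: fm fn Z_def) simp
  have c1: "of_int (ccoef m n k (i + 1) j)
      = of_int (int q + 1) * of_int (int n - j) * Z * wsum m n k (i + 1) j"
    using ccoef_eq_wsum[OF assms(1), of "i + 1" j "Suc q"] q assms by (simp only: fn Z_def) simp
  have c2: "of_int (ccoef m n k i (j + 1))
      = of_int (int q + 1) * of_int (int m - i) * Z * wsum m n k i (j + 1)"
    using ccoef_eq_wsum[OF assms(1), of i "j + 1" "Suc q"] q assms by (simp only: fm Z_def) simp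
  have e: "i + j - int k = int q" using q by simp
  have "(of_int ((i + j - int k + 1) * (int m + int n - int k - i - j) * ccoef m n k i j) :: rat)
     = of_int (int q + 1) * of_int (int m - i) * of_int (int n - j) * Z
       * (of_int (int m + int n - int k - i - j) * wsum m n k i j)"
    unfolding e of_int_mult c0 by simp
  also have "\<dots> = of_int ((i + 1) * (int m - i) * ccoef m n k (i + 1) j
      + (j + 1) * (int n - j) * ccoef m n k i (j + 1))"
    unfolding wsum_pascal_reflected of_int_add[of "_ * _"] of_int_mult c1 c2 by (simp only: algebra_simps)
  finally show ?thesis by (simp only: of_int_eq_iff)
qed

section \<open>The central value and the entry below it\<close>

text \<open>With \<open>w = t - c\<close> the denominators are the factorials of
  \<open>c + w\<close>, \<open>c - w\<close>, \<open>a + w\<close>, \<open>a - w\<close>,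
  \<open>b + w\<close>, \<open>b - w\<close>. Induction on \<open>a\<close> works well because the
  range of \<open>t\<close> is independent of \<open>a\<close>, so the telescoped sum has no extra
  boundary terms.\<close>

lemma dixon:
  "wsum (2 * c + 2 * a) (2 * c + 2 * b) (2 * c) (int (c + a)) (int (c + b))
    = (-1) ^ c * fact (a + b + c)
      / (fact a * fact b * fact c * fact (a + b) * fact (b + c) * fact (a + c))"
proof -
  define f where "f a t = (-1) ^ t * rfact (int t) * rfact (2 * int c - int t)
     * rfact (int a - int c + int t) * rfact (int a + int c - int t)
     * rfact (int b + int c - int t) * rfact (int b - int c + int t)" for a t
  have "(\<Sum>t\<le>2 * c. f a t) = (-1) ^ c * fact (a + b + c)
      / (fact a * fact b * fact c * fact (a + b) * fact (b + c) * fact (a + c))"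
  proof (induction a)
    case 0
    \<comment> \<open>For \<open>a = 0\<close> the factors with arguments \<open>t - c\<close> and
      \<open>c - t\<close> leave only \<open>t = c\<close>.\<close>
    have "(\<Sum>t\<le>2 * c. f 0 t)
        = (\<Sum>t\<le>2 * c. if t = c then (-1) ^ c * rfact (int c) * rfact (int c) * rfact (int b) * rfact (int b) else 0)"
      by (rule sum.cong) (auto simp: f_def rfact_def)
    then show ?case by (simp add: add.commute)
  next
    case (Suc a)
    \<comment> \<open>With \<open>A = a + 1\<close> and \<open>w = t - c\<close>, the certificate \<open>h\<close> rests on
      \<open>2 (A (A+b) (A+c) - (A+b+c) (A^2 - w^2)) = (A+w) (b+w) (c+w) + (A-w) (b-w) (c-w)\<close>.\<close>
    define h where "h t = (-1) ^ t * rfact (int t - 1) * rfact (2 * int c - int t)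
       * rfact (int a - int c + int t) * rfact (int (Suc a) + int c - int t)
       * rfact (int b + int c - int t) * rfact (int b - int c + int t - 1)" for t
    have eq: "2 * (of_nat (Suc a) * of_nat (a + b + 1) * of_nat (a + c + 1) * f (Suc a) t
        - of_nat (a + b + c + 1) * f a t) = h t - h (Suc t)" for t
    proof -
      \<comment> \<open>In the notation above these are \<open>c + w\<close>, \<open>c - w\<close>,
        \<open>A + w\<close>, \<open>A - w\<close>, \<open>b - w\<close>, \<open>b + w\<close>, so
        \<open>p * x\<close> is \<open>A^2 - w^2\<close>.\<close>
      define u v p x r y :: int where "u = int t" and "v = 2 * int c - int t"
        and "p = int a + 1 - int c + int t" and "x = int a + 1 + int c - int t"
        and "r = int b + int c - int t" and "y = int b - int c + int t"
      have f1: "f (Suc a) t = (-1) ^ t * rfact u * rfact v * rfact p * rfact x * rfact r * rfact y"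
        unfolding f_def u_def v_def p_def x_def r_def y_def by (simp add: algebra_simps)
      have f2: "f a t = (-1) ^ t * rfact u * rfact v * rfact (p - 1) * rfact (x - 1) * rfact r * rfact y"
        unfolding f_def u_def v_def p_def x_def r_def y_def by (simp add: algebra_simps)
      have h1: "h t = (-1) ^ t * rfact (u - 1) * rfact v * rfact (p - 1) * rfact x * rfact r * rfact (y - 1)"
        unfolding h_def u_def v_def p_def x_def r_def y_def by (simp add: algebra_simps)
      have h2: "h (Suc t)
          = - ((-1) ^ t * rfact u * rfact (v - 1) * rfact p * rfact (x - 1) * rfact (r - 1) * rfact y)"
        unfolding h_def u_def v_def p_def x_def r_def y_def by (simp add: algebra_simps)
      define F where "F = (-1) ^ t * rfact u * rfact v * rfact p * rfact x * rfact r * rfact y"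
      have "2 * (int (Suc a) * int (a + b + 1) * int (a + c + 1) - int (a + b + c + 1) * (p * x))
          = u * p * y + v * x * r"
        by (simp add: u_def v_def p_def x_def r_def y_def algebra_simps)
      from arg_cong[OF this, of "\<lambda>z. of_int z * F"]
      have "2 * (of_nat (Suc a) * of_nat (a + b + 1) * of_nat (a + c + 1)
          - of_nat (a + b + c + 1) * (of_int p * of_int x)) * F
          = (of_int u * of_int p * of_int y + of_int v * of_int x * of_int r) * F"
        by (simp only: of_int_mult of_int_add of_int_diff of_int_of_nat_eq of_int_numeral)
      moreover have "f (Suc a) t = F" "f a t = of_int p * of_int x * F"
        "h t = of_int u * of_int p * of_int y * F" "h (Suc t) = - (of_int v * of_int x * of_int r * F)"
        unfolding f1 f2 h1 h2 F_def rfact_pred[of u] rfact_pred[of v] rfact_pred[of p]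
          rfact_pred[of x] rfact_pred[of r] rfact_pred[of y]
        by (simp_all only: mult_ac mult_minus_left mult_minus_right)
      ultimately show ?thesis
        by (simp only: left_diff_distrib right_diff_distrib distrib_right mult.assoc)
    qed
    have "(\<Sum>t\<le>2 * c. h t - h (Suc t)) = 0"
      unfolding sum_telescope by (simp add: h_def)
    then have "of_nat (Suc a) * of_nat (a + b + 1) * of_nat (a + c + 1) * (\<Sum>t\<le>2 * c. f (Suc a) t)
        = of_nat (a + b + c + 1) * (\<Sum>t\<le>2 * c. f a t)"
      unfolding eq[symmetric] sum_distrib_left[symmetric] sum_subtractf by simp
    then have "(\<Sum>t\<le>2 * c. f (Suc a) t)
        = of_nat (Suc (a + b + c)) * (\<Sum>t\<le>2 * c. f a t)
          / (of_nat (Suc a) * of_nat (Suc (a + b)) * of_nat (Suc (a + c)))"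
      by (simp add: field_simps del: of_nat_Suc of_nat_add)
    then show ?case
      unfolding Suc.IH by (simp add: mult.assoc mult.left_commute del: of_nat_Suc of_nat_add)
  qed
  moreover have "wsum (2 * c + 2 * a) (2 * c + 2 * b) (2 * c) (int (c + a)) (int (c + b))
      = (\<Sum>t\<le>2 * c. f a t)"
    unfolding wsum_def by (rule sum.cong) (auto simp: wterm_def f_def algebra_simps)
  ultimately show ?thesis by simp
qed

text \<open>The reflected relation at the centre \<open>(M, N)\<close> involves its two successors;
  the Pascal relation expresses each of them by the centre and one neighbour in the central column.
  As \<open>2 * c\<close> is even, reflection makes these two neighbours equal, and one unknown is
  left.\<close>

lemma wsum_next_to_center:
  fixes a b c :: nat
  defines "W \<equiv> wsum (2 * c + 2 * a) (2 * c + 2 * b) (2 * c)"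
    and "M \<equiv> int (c + a)" and "N \<equiv> int (c + b)" and "q \<equiv> int (a + b)"
  shows "2 * of_int (M + 1) * of_int (N + 1) * W (M + 1) (N - 1)
    = of_int (q * (q + 1) - M * (M + 1) - N * (N + 1)) * W M N"
proof -
  have sym: "W (M - 1) (N + 1) = W (M + 1) (N - 1)"
    using wsum_reflect[of "2 * c + 2 * a" "2 * c + 2 * b" "2 * c" "M + 1" "N - 1"]
    by (simp add: W_def M_def N_def algebra_simps)
  have 1: "of_int (q + 1) * W M (N + 1) = of_int (M + 1) * W (M - 1) (N + 1) + of_int N * W M N"
    using wsum_pascal[of M "N + 1" "2 * c" "2 * c + 2 * a" "2 * c + 2 * b"]
    by (simp add: W_def M_def N_def q_def algebra_simps)
  have 2: "of_int (q + 1) * W (M + 1) N = of_int M * W M N + of_int (N + 1) * W (M + 1) (N - 1)"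
    using wsum_pascal[of "M + 1" N "2 * c" "2 * c + 2 * a" "2 * c + 2 * b"]
    by (simp add: W_def M_def N_def q_def algebra_simps)
  have 3: "of_int q * W M N = of_int (M + 1) * W (M + 1) N + of_int (N + 1) * W M (N + 1)"
    using wsum_pascal_reflected[of "2 * c + 2 * a" "2 * c + 2 * b" "2 * c" M N]
    by (simp add: W_def M_def N_def q_def algebra_simps)
  have "of_int (q + 1) * (of_int q * W M N)
      = of_int (M + 1) * (of_int (q + 1) * W (M + 1) N) + of_int (N + 1) * (of_int (q + 1) * W M (N + 1))"
    unfolding 3 by (simp only: distrib_left mult.left_commute)
  then show ?thesis
    unfolding 1 2 sym by (simp add: algebra_simps)
qed

section \<open>The recurrences for the normalised entries\<close>

lemma lam_double: "lam (2 * s) = 4 * of_nat s * (of_nat s + 1)"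
  by (simp add: lam_def algebra_simps)

theorem theorem4:
  fixes m n k m' :: nat and X :: rat
  assumes "even m" and "even n" and "even k" and "k \<le> min m n"
    and "m' = m + n - 2 * k" and "m \<ge> 2" and "m' \<ge> 2"
    and "X = of_int (ccoef m n k (int (m div 2)) (int (n div 2)))"
  shows "X = of_int (Mmat m n k $$ (m div 2, m' div 2))
    \<and> X = (-1) ^ (k div 2) * fact ((m + n - k) div 2)
           / (fact ((m - k) div 2) * fact ((n - k) div 2) * fact (k div 2))
    \<and> (\<forall>s. 1 \<le> s \<and> s \<le> m div 2 \<longrightarrow>
         Mmat m n k $$ (m div 2 + s, m' div 2)
           = ccoef_ext m n k (int (m div 2) + int s) (int (n div 2) - int s) \<and>
         Mmat m n k $$ (m div 2 + s, m' div 2 + 1)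
           = ccoef_ext m n k (int (m div 2) + int s) (int (n div 2) - int s + 1))
    \<and> (\<forall>A B :: nat \<Rightarrow> rat.
         (\<forall>s. 1 \<le> s \<and> s \<le> m div 2 \<longrightarrow>
            A s * X = of_int (Mmat m n k $$ (m div 2 + s, m' div 2)) \<and>
            B s * X = of_int (Mmat m n k $$ (m div 2 + s, m' div 2 + 1))) \<longrightarrow>
         A 1 = (lam m' - lam m - lam n) / (2 * lam m) \<and>
         B 1 = (lam m' + lam m - lam n) / (2 * lam m) \<and>
         (\<forall>s. 1 \<le> s \<and> s < m div 2 \<longrightarrow>
            A (s + 1) = ((lam m' - lam m + lam (2 * s)) * A s + (lam (2 * s - 2) - lam n) * B s)
                          / (lam m - lam (2 * s)) \<and>
            B (s + 1) = (lam m' * A s + (lam (2 * s - 2) - lam n) * B s)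
                          / (lam m - lam (2 * s))))"
proof -
  obtain c where k: "k = 2 * c" using \<open>even k\<close> by (auto elim: evenE)
  obtain a where m: "m = 2 * c + 2 * a"
  proof -
    obtain d where "m = 2 * d" using \<open>even m\<close> by (auto elim: evenE)
    then show thesis using that[of "d - c"] assms(4) k by (simp add: diff_mult_distrib2)
  qed
  obtain b where n: "n = 2 * c + 2 * b"
  proof -
    obtain d where "n = 2 * d" using \<open>even n\<close> by (auto elim: evenE)
    then show thesis using that[of "d - c"] assms(4) k by (simp add: diff_mult_distrib2)
  qed
  have m': "m' = 2 * (a + b)" using assms(5) by (simp add: k m n)
  have ca: "1 \<le> c + a" and ab: "1 \<le> a + b" using assms(6,7) m m' by auto
  have half: "m div 2 = c + a" "n div 2 = c + b" "k div 2 = c" "m' div 2 = a + b"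
    by (simp_all add: k m n m')
  define M N q where "M = int (c + a)" and "N = int (c + b)" and "q = int (a + b)"
  define C where "C s = ccoef m n k (M + int s) (N - int s)" for s
  define D where "D s = ccoef m n k (M + int s) (N - int s + 1)" for s

  have X: "X = of_int (C 0)" using assms(8) by (simp add: half C_def M_def N_def)
  have entC: "Mmat m n k $$ (m div 2 + s, m' div 2) = ccoef_ext m n k (M + int s) (N - int s)"
    if "s \<le> m div 2" for s
    using that unfolding Mmat_def half
    by (subst index_mat) (auto simp: k m n M_def N_def algebra_simps)
  \<comment> \<open>The fact \<open>ab\<close> ensures that there is a column to the right of the
    central one.\<close>
  have entD: "Mmat m n k $$ (m div 2 + s, m' div 2 + 1) = ccoef_ext m n k (M + int s) (N - int s + 1)"
    if "s \<le> m div 2" for s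
    using that ab unfolding Mmat_def half
    by (subst index_mat) (auto simp: k m n M_def N_def algebra_simps)
  \<comment> \<open>A nonzero first binomial would force \<open>l \<ge> k - j > k\<close>; so for
    negative \<open>j\<close> the formula itself gives the zero of the extension.\<close>
  have neg: "ccoef m n k i j = 0" if "j < 0" for i j
    unfolding ccoef_def by (rule sum.neutral) (use that in \<open>auto simp: zbinom_def\<close>)
  have extC: "ccoef_ext m n k (M + int s) (N - int s) = C s" for s
    using neg[of "N - int s"] by (auto simp: ccoef_ext_def C_def N_def n not_le)
  \<comment> \<open>At \<open>s = 0\<close> the second index is \<open>N + 1\<close>, which exceeds
    \<open>n\<close> when \<open>n = 0\<close>; hence the bound on \<open>s\<close>.\<close>
  have extD: "ccoef_ext m n k (M + int s) (N - int s + 1) = D s" if "1 \<le> s" for s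
    using that neg[of "N - int s + 1"] by (auto simp: ccoef_ext_def D_def N_def n not_le)

  define W where "W = wsum m n k M N"
  have X_W: "X = fact (a + b) * fact (c + a) * fact (c + b) * W"
  proof -
    have "nat (int m - M) = c + a" "nat (int n - N) = c + b" by (simp_all add: M_def N_def m n)
    then show ?thesis
      using ccoef_eq_wsum[OF assms(4), of M N "a + b"] by (simp add: X C_def W_def M_def N_def k m n)
  qed
  \<comment> \<open>The weights in \<open>X_W\<close> cancel the last three factorials in the
    denominator of \<open>dixon\<close>.\<close>
  have closed: "X = (-1) ^ c * fact (a + b + c) / (fact a * fact b * fact c)"
    unfolding X_W W_def M_def N_def k m n dixon by (simp add: add.commute divide_simps)
  then have X0: "X \<noteq> 0" by simp

  have pascal: "D (Suc s) = C s + C (Suc s)" for s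
    using ccoef_pascal[of "M + int (Suc s)" "N - int s" k m n] ab
    by (simp add: C_def D_def M_def N_def k algebra_simps)
  \<comment> \<open>The weights at \<open>(M + 1, N - 1)\<close> contain \<open>(M-1)!\<close> and
    \<open>(N+1)!\<close>: multiplying by \<open>M\<close> completes the former to
    \<open>M!\<close>, and the latter supplies the factor \<open>N + 1\<close> of
    \<open>wsum_next_to_center\<close>.\<close>
  have first: "2 * of_int (M * (M + 1)) * of_int (C 1)
      = (of_int (q * (q + 1) - M * (M + 1) - N * (N + 1)) :: rat) * X"
  proof -
    obtain e where e: "c + a = Suc e" using ca by (metis Suc_le_D One_nat_def)
    have "nat (int m - (M + 1)) = e" "nat (int n - (N - 1)) = Suc (c + b)"
      using e by (simp_all add: M_def N_def m n)
    then have "of_int (C 1) = fact (a + b) * fact e * fact (Suc (c + b)) * wsum m n k (M + 1) (N - 1)"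
      using ccoef_eq_wsum[OF assms(4), of "M + 1" "N - 1" "a + b"] ca
      by (simp add: C_def M_def N_def k m n del: fact_Suc)
    then have MC: "of_int M * of_int (C 1)
        = fact (a + b) * fact (c + a) * fact (c + b) * (of_int (N + 1) * wsum m n k (M + 1) (N - 1))"
      unfolding M_def e by (simp add: N_def algebra_simps)
    have next_to_center: "2 * of_int (M + 1) * of_int (N + 1) * wsum m n k (M + 1) (N - 1)
        = of_int (q * (q + 1) - M * (M + 1) - N * (N + 1)) * W"
      unfolding W_def M_def N_def q_def k m n by (rule wsum_next_to_center)
    have "2 * of_int (M * (M + 1)) * of_int (C 1)
        = 2 * of_int (M + 1) * (of_int M * of_int (C 1) :: rat)"
      by (simp only: of_int_mult mult_ac)
    also have "\<dots> = fact (a + b) * fact (c + a) * fact (c + b)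
          * (2 * of_int (M + 1) * of_int (N + 1) * wsum m n k (M + 1) (N - 1))"
      unfolding MC by (simp only: mult_ac)
    also have "\<dots> = of_int (q * (q + 1) - M * (M + 1) - N * (N + 1)) * X"
      unfolding next_to_center X_W by (simp only: mult_ac)
    finally show ?thesis .
  qed
  \<comment> \<open>The reflected relation at the entry \<open>C s\<close>: its successors
    \<open>D (Suc s)\<close> and \<open>D s\<close> both lie in the next column.\<close>
  have step: "(q + 1) * q * C s
      = (M + int s + 1) * (M - int s) * D (Suc s) + (N - int s + 1) * (N + int s) * D s"
    if "1 \<le> s" "s < c + a" for s
    using ccoef_reflected_pascal[OF assms(4), of "M + int s" "N - int s"] that
    by (simp add: C_def D_def M_def N_def q_def k m n algebra_simps)

  have lams: "lam m' = 4 * of_int (q * (q + 1))" "lam m = 4 * of_int (M * (M + 1))"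
    "lam n = 4 * of_int (N * (N + 1))"
    using lam_double[of "a + b"] lam_double[of "c + a"] lam_double[of "c + b"]
    by (simp_all add: m' m n q_def M_def N_def)

  have rec: "A 1 = (lam m' - lam m - lam n) / (2 * lam m) \<and>
      B 1 = (lam m' + lam m - lam n) / (2 * lam m) \<and>
      (\<forall>s. 1 \<le> s \<and> s < m div 2 \<longrightarrow>
        A (s + 1) = ((lam m' - lam m + lam (2 * s)) * A s + (lam (2 * s - 2) - lam n) * B s)
                      / (lam m - lam (2 * s)) \<and>
        B (s + 1) = (lam m' * A s + (lam (2 * s - 2) - lam n) * B s) / (lam m - lam (2 * s)))"
    if AB: "\<forall>s. 1 \<le> s \<and> s \<le> m div 2 \<longrightarrow>
      A s * X = of_int (Mmat m n k $$ (m div 2 + s, m' div 2)) \<and>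
      B s * X = of_int (Mmat m n k $$ (m div 2 + s, m' div 2 + 1))" for A B :: "nat \<Rightarrow> rat"
  proof -
    have A: "A s * X = of_int (C s)" and B: "B s * X = of_int (D s)" if "1 \<le> s" "s \<le> c + a" for s
      using AB[rule_format, of s] that extC extD entC entD by (auto simp: half)
    have "lam m > 0" using ca unfolding lams(2) M_def by auto
    have AC: "of_int (C 1) = A 1 * X" using A[of 1] ca by simp
    have "(2 * lam m * A 1) * X = 4 * (2 * of_int (M * (M + 1)) * of_int (C 1))"
      unfolding AC lams by (simp only: mult_ac)
    also have "\<dots> = (lam m' - lam m - lam n) * X"
      unfolding first lams of_int_diff by (simp only: right_diff_distrib left_diff_distrib mult_ac)
    finally have A1: "2 * lam m * A 1 = lam m' - lam m - lam n" using X0 by simp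
    have "B 1 * X = (A 1 + 1) * X"
      using pascal[of 0] A[of 1] B[of 1] ca X by (simp add: algebra_simps)
    then have B1: "B 1 = A 1 + 1" using X0 by simp
    have "A (s + 1) = ((lam m' - lam m + lam (2 * s)) * A s + (lam (2 * s - 2) - lam n) * B s)
                      / (lam m - lam (2 * s)) \<and>
        B (s + 1) = (lam m' * A s + (lam (2 * s - 2) - lam n) * B s) / (lam m - lam (2 * s))"
      if s: "1 \<le> s" "s < c + a" for s
    proof -
      define S where "S = int s"
      have l1: "lam (2 * s) = 4 * of_int (S * (S + 1))"
        using lam_double[of s] by (simp add: S_def)
      \<comment> \<open>Since \<open>s \<ge> 1\<close>, the subtraction \<open>2 * s - 2\<close> is
        not truncated.\<close>
      have l2: "lam (2 * s - 2) = 4 * of_int ((S - 1) * S)"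
        using lam_double[of "s - 1"] s by (simp add: S_def of_nat_diff diff_mult_distrib2)
      \<comment> \<open>From \<open>M*(M+1) - S*(S+1) = (M+S+1)*(M-S)\<close>; together with
        \<open>d2\<close> and \<open>d3\<close> this identifies the coefficients of
        \<open>step\<close> with values and differences of \<open>lam\<close>.\<close>
      have d1: "lam m - lam (2 * s) = 4 * of_int ((M + S + 1) * (M - S))"
        unfolding lams l1 by (simp add: algebra_simps)
      have d2: "lam (2 * s - 2) - lam n = - 4 * of_int ((N - S + 1) * (N + S))"
        unfolding lams l2 by (simp add: algebra_simps)
      have d3: "lam m' = 4 * of_int ((q + 1) * q)"
        unfolding lams by (simp only: mult_ac)
      have "(M + S + 1) * (M - S) > 0" using s by (simp add: M_def S_def)
      with d1 have pos: "lam m - lam (2 * s) > 0"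
        by (metis mult_pos_pos of_int_0_less_iff zero_less_numeral)
      have "B (s + 1) * X = (A s + A (s + 1)) * X"
        using pascal[of s] A[of s] A[of "s + 1"] B[of "s + 1"] s by (simp add: algebra_simps)
      then have BA: "B (s + 1) = A s + A (s + 1)" using X0 by simp
      have "(of_int ((q + 1) * q * C s) :: rat)
          = of_int ((M + S + 1) * (M - S) * D (Suc s) + (N - S + 1) * (N + S) * D s)"
        unfolding S_def using step[OF s] by (simp only:)
      then have "of_int ((q + 1) * q) * (A s * X) = of_int ((M + S + 1) * (M - S)) * (B (s + 1) * X)
          + of_int ((N - S + 1) * (N + S)) * (B s * X)"
        using A[of s] B[of s] B[of "s + 1"] s by simp
      then have "(of_int ((q + 1) * q) * A s) * X = (of_int ((M + S + 1) * (M - S)) * B (s + 1)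
          + of_int ((N - S + 1) * (N + S)) * B s) * X"
        by (simp only: algebra_simps)
      then have E: "of_int ((q + 1) * q) * A s = of_int ((M + S + 1) * (M - S)) * B (s + 1)
          + of_int ((N - S + 1) * (N + S)) * B s"
        using X0 by simp
      \<comment> \<open>This is \<open>step\<close> divided by \<open>X\<close>; substituting
        \<open>B (s + 1) = A s + A (s + 1)\<close> then gives the recurrence for
        \<open>A\<close>.\<close>
      have Bs: "(lam m - lam (2 * s)) * B (s + 1) = lam m' * A s + (lam (2 * s - 2) - lam n) * B s"
        unfolding d1 d2 d3 mult.assoc[of 4] mult.assoc[of "- 4"] E by simp
      then have As: "(lam m - lam (2 * s)) * A (s + 1)
          = (lam m' - lam m + lam (2 * s)) * A s + (lam (2 * s - 2) - lam n) * B s"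
        unfolding BA by (simp add: algebra_simps)
      show ?thesis using pos unfolding As[symmetric] Bs[symmetric] by simp
    qed
    moreover have "A 1 = (lam m' - lam m - lam n) / (2 * lam m)"
      unfolding A1[symmetric] using \<open>lam m > 0\<close> by simp
    moreover have "B 1 = (lam m' + lam m - lam n) / (2 * lam m)"
      unfolding B1 using \<open>lam m > 0\<close> A1 by (simp add: field_simps)
    ultimately show ?thesis by (simp add: half)
  qed

  have "X = of_int (Mmat m n k $$ (m div 2, m' div 2))"
    using entC[of 0] extC[of 0] X by simp
  moreover have "X = (-1) ^ (k div 2) * fact ((m + n - k) div 2)
           / (fact ((m - k) div 2) * fact ((n - k) div 2) * fact (k div 2))"
    unfolding closed by (simp add: k m n add_ac)
  moreover have "Mmat m n k $$ (m div 2 + s, m' div 2)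
           = ccoef_ext m n k (int (m div 2) + int s) (int (n div 2) - int s) \<and>
         Mmat m n k $$ (m div 2 + s, m' div 2 + 1)
           = ccoef_ext m n k (int (m div 2) + int s) (int (n div 2) - int s + 1)"
    if "1 \<le> s \<and> s \<le> m div 2" for s
    using entC[of s] entD[of s] that by (simp add: half M_def N_def)
  ultimately show ?thesis using rec by blast
qed

end
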